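(* There exists a $2$-BSA$(3,c,3,1;\mathrm{IS})$ for any odd integer $c$ with $c\geq 9$.
   Context: $Z_n=\{0,1,\ldots,n-1\}$ denotes the integers modulo $n$. For $(x,y)\in Z_r\times Z_c$, the eight points $(x-1,y)$, $(x+1,y)$, $(x,y-1)$, $(x,y+1)$, $(x-1,y-1)$, $(x-1,y+1)$, $(x+1,y-1)$, $(x+1,y+1)$ (first coordinate reduced modulo $r$, second modulo $c$) are said to be strongly $2$-contiguous to $(x,y)$. A $2$-BSA$(r,c,k,\lambda;\mathrm{IS})$ (two-dimensional balanced sampling plan avoiding strongly $2$-contiguous units) is a pair $(X,\mathcal B)$, where $X=Z_r\times Z_c$ and $\mathcal B$ is a collection of $k$-subsets of $X$, called blocks, such that two strongly $2$-contiguous points never appear together in a block, while any two distinct points that are not strongly $2$-contiguous appear together in exactly $\lambda$ blocks. *)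

theory Defs
  imports Main "HOL-Library.Multiset"
begin

definition grid :: "nat \<Rightarrow> nat \<Rightarrow> (int \<times> int) set" where
  "grid r c = {0..<int r} \<times> {0..<int c}"

fun strongly_contiguous2 ::
    "nat \<Rightarrow> nat \<Rightarrow> int \<times> int \<Rightarrow> int \<times> int \<Rightarrow> bool" where
  "strongly_contiguous2 r c (x, y) q \<longleftrightarrow>
     q \<in> (\<lambda>(u, v). (u mod int r, v mod int c)) `
       {(x - 1, y), (x + 1, y), (x, y - 1), (x, y + 1),
        (x - 1, y - 1), (x - 1, y + 1), (x + 1, y - 1), (x + 1, y + 1)}"

text \<open>
  The blocks form a multiset, since a block design may have repeated blocks.
  Both pair conditions concern two distinct points: for small \<open>r\<close> or \<open>c\<close> a point
  may be strongly contiguous to itself because of the reduction modulo \<open>r\<close> and \<open>c\<close>.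
\<close>

definition BSA2_IS ::
    "nat \<Rightarrow> nat \<Rightarrow> nat \<Rightarrow> nat \<Rightarrow> (int \<times> int) set \<Rightarrow> (int \<times> int) set multiset \<Rightarrow> bool" where
  "BSA2_IS r c k l X \<B> \<longleftrightarrow>
     X = grid r c \<and>
     (\<forall>B \<in># \<B>. B \<subseteq> X \<and> card B = k) \<and>
     (\<forall>p \<in> X. \<forall>q \<in> X. p \<noteq> q \<and> strongly_contiguous2 r c p q \<longrightarrow>
        \<not> (\<exists>B \<in># \<B>. p \<in> B \<and> q \<in> B)) \<and>
     (\<forall>p \<in> X. \<forall>q \<in> X. p \<noteq> q \<and> \<not> strongly_contiguous2 r c p q \<longrightarrow>
        size {#B \<in># \<B>. p \<in> B \<and> q \<in> B#} = l)"

end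

(*
  Modulo 3 two points are contiguous as soon as their columns differ by 0, 1 or -1, so the first
  coordinate only serves as a level. Bose's blocks {(i, x), (i, x + 2j), (i + 1, x + j)} with
  1 <= j <= (c - 1) / 2 cover every pair of points in distinct columns exactly once. Measure the
  columns in quarters, which is possible since c is odd: the contiguous columns then differ
  by 4 or -4. Deleting the base blocks with j = 1, 2, 3, 4 uncovers, up to sign, the level-0
  differences 2, 4, 6, 8 and the mixed-level differences 1, 2, 3, 4; apart from the forbidden
  difference 4 these are covered again by the three base blocks
  {(0,0), (0,2), (0,8)}, {(0,0), (2,3), (1,1)}, {(0,0), (1,3), (2,2)}.
*)

theory Submission
  imports Defs "HOL-Library.Product_Plus" "HOL-Number_Theory.Cong"
begin

section \<open>Residues and translation-invariant contiguity in Z_r x Z_c\<close>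

definition residue :: "nat \<Rightarrow> nat \<Rightarrow> int \<times> int \<Rightarrow> int \<times> int" where
  "residue r c p = (fst p mod int r, snd p mod int c)"

definition translate :: "nat \<Rightarrow> nat \<Rightarrow> (int \<times> int) set \<Rightarrow> int \<times> int \<Rightarrow> (int \<times> int) set" where
  "translate r c B g = (\<lambda>b. residue r c (g + b)) ` B"

definition noncontiguous :: "nat \<Rightarrow> nat \<Rightarrow> (int \<times> int) set" where
  "noncontiguous r c = {d \<in> grid r c. d \<noteq> 0 \<and> \<not> strongly_contiguous2 r c 0 d}"

text \<open>The index stays in the triple so that a pair lying in two base blocks counts twice, and
  so that an injective difference map recovers the base block too.\<close>

definition ordered_pairs :: "'j set \<Rightarrow> ('j \<Rightarrow> 'a set) \<Rightarrow> ('j \<times> 'a \<times> 'a) set" where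
  "ordered_pairs J T = (SIGMA j:J. {(a, b). a \<in> T j \<and> b \<in> T j \<and> a \<noteq> b})"

lemma residue_add_left: "residue r c (residue r c p + q) = residue r c (p + q)"
  by (simp add: residue_def mod_simps)

lemma residue_diff_residues: "residue r c (residue r c p - residue r c q) = residue r c (p - q)"
  by (simp add: residue_def mod_simps)

lemma residue_diff_left: "residue r c (residue r c p - q) = residue r c (p - q)"
  by (simp add: residue_def mod_simps)

lemma residue_eq_iff: "residue r c p = residue r c q \<longleftrightarrow> residue r c (p - q) = 0"
  by (auto simp: residue_def mod_eq_dvd_iff zero_prod_def mod_eq_0_iff_dvd)

lemma residue_id: "p \<in> grid r c \<Longrightarrow> residue r c p = p"
  by (auto simp: residue_def grid_def)

lemma residue_in_grid: "r > 0 \<Longrightarrow> c > 0 \<Longrightarrow> residue r c p \<in> grid r c"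
  by (auto simp: residue_def grid_def)

lemma finite_grid: "finite (grid r c)"
  by (simp add: grid_def)

lemma strongly_contiguous2_iff:
  "strongly_contiguous2 r c p q \<longleftrightarrow>
     (\<exists>d \<in> {-1, 0, 1} \<times> {-1, 0, 1} - {0}. q = residue r c (p + d))"
proof -
  have neighbours: "{-1, 0, 1} \<times> {-1, 0, 1} - {0 :: int \<times> int} =
      {(-1, 0), (1, 0), (0, -1), (0, 1), (-1, -1), (-1, 1), (1, -1), (1, 1)}"
    by (auto simp: zero_prod_def)
  show ?thesis
    unfolding neighbours by (cases p) (simp add: residue_def)
qed

text \<open>Adding an offset commutes with translation, so contiguity depends on differences only.
  This lets the whole plan be developed from base blocks.\<close>

lemma strongly_contiguous2_diff:
  assumes "q \<in> grid r c"
  shows "strongly_contiguous2 r c p q \<longleftrightarrow> strongly_contiguous2 r c 0 (residue r c (q - p))"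
proof -
  have "q = residue r c (p + d) \<longleftrightarrow> residue r c (q - p) = residue r c (0 + d)" for d
    using residue_eq_iff[of r c q "p + d"] residue_eq_iff[of r c "q - p" d] residue_id[OF assms]
    by (simp add: algebra_simps)
  then show ?thesis
    unfolding strongly_contiguous2_iff by simp
qed

section \<open>Development of base blocks into a plan\<close>

lemma card_ordered_pairs:
  assumes "finite J" "\<And>j. j \<in> J \<Longrightarrow> finite (T j)" "\<And>j. j \<in> J \<Longrightarrow> card (T j) = k"
  shows "finite (ordered_pairs J T)" "card (ordered_pairs J T) = card J * (k * (k - 1))"
proof -
  have eq: "{(a, b). a \<in> T j \<and> b \<in> T j \<and> a \<noteq> b} = T j \<times> T j - (\<lambda>a. (a, a)) ` T j" for j
    by auto
  have fin: "finite {(a, b). a \<in> T j \<and> b \<in> T j \<and> a \<noteq> b}" if "j \<in> J" for j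
    unfolding eq using assms(2)[OF that] by simp
  have card: "card {(a, b). a \<in> T j \<and> b \<in> T j \<and> a \<noteq> b} = k * (k - 1)" if "j \<in> J" for j
  proof -
    have "card ((\<lambda>a. (a, a)) ` T j) = k"
      using assms(3)[OF that] by (subst card_image) (auto simp: inj_on_def)
    then show ?thesis
      unfolding eq using assms(2,3)[OF that]
      by (subst card_Diff_subset) (auto simp: card_cartesian_product algebra_simps)
  qed
  show "finite (ordered_pairs J T)"
    unfolding ordered_pairs_def using assms(1) fin by (intro finite_SigmaI)
  show "card (ordered_pairs J T) = card J * (k * (k - 1))"
    unfolding ordered_pairs_def using assms(1) fin card by (subst card_SigmaI) auto
qed

text \<open>
  Since there are exactly as many ordered pairs in base blocks as admissible differences,
  it suffices that every admissible difference occurs at least once.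
\<close>

lemma BSA2_IS_of_difference_cover:
  fixes J :: "'j set" and T :: "'j \<Rightarrow> (int \<times> int) set"
  assumes pos: "r > 0" "c > 0"
    and fin: "finite J" "\<And>j. j \<in> J \<Longrightarrow> finite (T j)"
    and card: "\<And>j. j \<in> J \<Longrightarrow> card (T j) = k"
    and cover: "noncontiguous r c \<subseteq> (\<lambda>(j, a, b). residue r c (b - a)) ` ordered_pairs J T"
    and count: "card J * (k * (k - 1)) = card (noncontiguous r c)"
  shows "BSA2_IS r c k 1 (grid r c)
    (image_mset (\<lambda>(j, g). translate r c (T j) g) (mset_set (J \<times> grid r c)))"
proof -
  define f where "f = (\<lambda>(j :: 'j, a, b). residue r c (b - a))"
  define Q where "Q = ordered_pairs J T"
  have finQ: "finite Q" and cardQ: "card Q = card (noncontiguous r c)"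
    unfolding Q_def using card_ordered_pairs[OF fin card] count by simp_all
  \<comment> \<open>The counts squeeze the image: it contains all admissible differences and cannot
    be larger. Equality forbids contiguous pairs in blocks, and injectivity of \<open>f\<close>
    gives uniqueness of the block through a pair.\<close>
  have "card (f ` Q) \<le> card Q"
    using finQ by (rule card_image_le)
  then have onto: "f ` Q = noncontiguous r c"
    using card_seteq[of "f ` Q" "noncontiguous r c"] finQ cover cardQ
    unfolding f_def Q_def by auto
  then have inj: "inj_on f Q"
    using finQ cardQ by (intro eq_card_imp_inj_on) simp_all
  have Q_iff: "(j, a, b) \<in> Q \<longleftrightarrow> j \<in> J \<and> a \<in> T j \<and> b \<in> T j \<and> a \<noteq> b" for j a b
    by (auto simp: Q_def ordered_pairs_def)
  have diff: "residue r c (b - a) \<in> noncontiguous r c"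
    if "j \<in> J" "a \<in> T j" "b \<in> T j" "a \<noteq> b" for j a b
    using onto that Q_iff[of j a b] by (force simp: f_def)
  have diff_points: "residue r c (residue r c (g + b) - residue r c (g + a)) = residue r c (b - a)"
    for a b g
    by (simp add: residue_diff_residues)
  \<comment> \<open>Two points that collide after reduction would have difference 0, which is not
    admissible.\<close>
  have inj_T: "inj_on (\<lambda>b. residue r c (g + b)) (T j)" if "j \<in> J" for j g
  proof (rule inj_onI, rule ccontr)
    fix a b
    assume ab: "a \<in> T j" "b \<in> T j" "residue r c (g + a) = residue r c (g + b)" "a \<noteq> b"
    then have "residue r c (b - a) = 0"
      using residue_eq_iff[of r c "g + b" "g + a"] by simp
    then show False
      using diff[OF that ab(1,2,4)] by (simp add: noncontiguous_def)
  qed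
  have block: "translate r c (T j) g \<subseteq> grid r c \<and> card (translate r c (T j) g) = k" if "j \<in> J" for j g
    unfolding translate_def
    using card_image[OF inj_T[OF that]] card[OF that] residue_in_grid[OF pos]
    by (simp add: image_subset_iff)
  have avoid: "\<not> strongly_contiguous2 r c p q"
    if j: "j \<in> J" and pq: "p \<in> translate r c (T j) g" "q \<in> translate r c (T j) g" "p \<noteq> q" for j g p q
  proof -
    obtain a b where ab: "a \<in> T j" "b \<in> T j" "p = residue r c (g + a)" "q = residue r c (g + b)"
      using pq by (auto simp: translate_def)
    then have "a \<noteq> b"
      using pq(3) by auto
    then have "residue r c (q - p) \<in> noncontiguous r c"
      using diff[OF j ab(1,2)] ab(3,4) diff_points by simp
    moreover have "q \<in> grid r c"
      using block[OF j] pq(2) by (meson subsetD)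
    ultimately show ?thesis
      using strongly_contiguous2_diff[of q r c p] by (simp add: noncontiguous_def)
  qed
  have once: "\<exists>!x. x \<in> J \<times> grid r c \<and> p \<in> (case x of (j, g) \<Rightarrow> translate r c (T j) g) \<and>
      q \<in> (case x of (j, g) \<Rightarrow> translate r c (T j) g)"
    if pq: "p \<in> grid r c" "q \<in> grid r c" "p \<noteq> q" "\<not> strongly_contiguous2 r c p q" for p q
  proof -
    have "residue r c (q - p) \<noteq> 0"
      using residue_eq_iff[of r c q p] residue_id[OF pq(1)] residue_id[OF pq(2)] pq(3) by simp
    then have "residue r c (q - p) \<in> f ` Q"
      unfolding onto noncontiguous_def
      using residue_in_grid[OF pos] strongly_contiguous2_diff[OF pq(2), of p] pq(4) by simp
    then obtain j a b where jab: "(j, a, b) \<in> Q" "residue r c (q - p) = residue r c (b - a)"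
      by (auto simp: f_def)
    \<comment> \<open>The translation by \<open>p - a\<close> moves \<open>a\<close> to
      \<open>p\<close>, and then \<open>b\<close> to \<open>q\<close> because \<open>b - a\<close>
      and \<open>q - p\<close> agree modulo \<open>r\<close> and \<open>c\<close>.\<close>
    have p: "residue r c (residue r c (p - a) + a) = p"
      using residue_id[OF pq(1)] by (simp add: residue_add_left)
    have q: "residue r c (residue r c (p - a) + b) = q"
    proof -
      have "residue r c (p - a + b) = residue r c q"
        using residue_eq_iff[of r c "p - a + b" q] residue_eq_iff[of r c "b - a" "q - p"] jab(2)
        by (simp add: algebra_simps)
      then show ?thesis
        using residue_id[OF pq(2)] by (simp add: residue_add_left)
    qed
    show ?thesis
    proof (rule ex1I[of _ "(j, residue r c (p - a))"], goal_cases)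
      case 1
      have "a \<in> T j" "b \<in> T j" "j \<in> J"
        using jab(1) Q_iff by auto
      then show ?case
        unfolding translate_def using p q residue_in_grid[OF pos]
        by (auto intro!: image_eqI[of p _ a] image_eqI[of q _ b])
    next
      case (2 x)
      then obtain j' g a' b' where x: "x = (j', g)" "j' \<in> J" "g \<in> grid r c" "a' \<in> T j'" "b' \<in> T j'"
        and pa: "p = residue r c (g + a')" and qb: "q = residue r c (g + b')"
        by (auto simp: translate_def)
      \<comment> \<open>Any block through \<open>p\<close> and \<open>q\<close> realises the same
        difference, so injectivity of \<open>f\<close> fixes its index and points; the translation
        is then forced to be \<open>p - a'\<close>.\<close>
      have "(j', a', b') \<in> Q"
        using x pa qb pq(3) Q_iff by auto
      moreover have "f (j', a', b') = f (j, a, b)"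
        using jab(2) diff_points[of g b' a'] by (simp add: f_def pa qb)
      ultimately have "j' = j" "a' = a"
        using inj jab(1) by (auto dest: inj_onD)
      moreover have "residue r c (p - a') = g"
        using residue_id[OF x(3)] by (simp add: pa residue_diff_left)
      ultimately show ?case
        using x(1) by simp
    qed
  qed
  \<comment> \<open>Multiplicities in the multiset of blocks become numbers of indices, so equal
    blocks from different indices count separately.\<close>
  have size: "size {#B \<in># image_mset F (mset_set A). p \<in> B \<and> q \<in> B#}
      = card {x \<in> A. p \<in> F x \<and> q \<in> F x}"
    if "finite A" for F :: "'j \<times> int \<times> int \<Rightarrow> (int \<times> int) set" and A p q
    using that by (simp add: filter_mset_image_mset filter_mset_mset_set)
  show ?thesis
    unfolding BSA2_IS_def
  proof (intro conjI ballI impI, goal_cases)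
    case (2 B)
    then show ?case
      using block fin(1) finite_grid by auto
  next
    case (3 B)
    then show ?case
      using block fin(1) finite_grid by auto
  next
    case (4 p q)
    show ?case
    proof
      assume "\<exists>B \<in># image_mset (\<lambda>(j, g). translate r c (T j) g) (mset_set (J \<times> grid r c)).
        p \<in> B \<and> q \<in> B"
      then obtain j g where "j \<in> J" "p \<in> translate r c (T j) g" "q \<in> translate r c (T j) g"
        using fin(1) finite_grid by auto
      then show False
        using avoid 4(3) by blast
    qed
  next
    case (5 p q)
    let ?S = "{x \<in> J \<times> grid r c. p \<in> (case x of (j, g) \<Rightarrow> translate r c (T j) g) \<and>
      q \<in> (case x of (j, g) \<Rightarrow> translate r c (T j) g)}"
    have "\<exists>!x. x \<in> ?S"
      using once[of p q] 5 unfolding mem_Collect_eq by blast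
    then obtain x where "?S = {x}"
      by blast
    then have "card ?S = 1"
      by (rule ssubst) simp
    then show ?case
      unfolding size[OF finite_cartesian_product[OF fin(1) finite_grid]] .
  qed simp
qed

section \<open>Admissible differences for three rows\<close>

lemma noncontiguous_3:
  assumes "c \<ge> 3"
  shows "noncontiguous 3 c = {0..<3} \<times> {2..<int c - 1}"
proof -
  have m: "- 1 mod int c = int c - 1" "1 mod int c = 1"
    using assms by (auto simp: zmod_minus1)
  have "strongly_contiguous2 3 c 0 d \<longleftrightarrow>
      d \<in> {(2, 0), (1, 0), (0, int c - 1), (0, 1),
        (2, int c - 1), (2, 1), (1, int c - 1), (1, 1)}" for d
    using assms by (simp add: zero_prod_def m)
  then have iff: "(u, v) \<in> noncontiguous 3 c \<longleftrightarrow> 0 \<le> u \<and> u < 3 \<and> 0 \<le> v \<and> v < int c \<and>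
      (u, v) \<notin> {(0, 0), (2, 0), (1, 0), (0, int c - 1), (0, 1),
        (2, int c - 1), (2, 1), (1, int c - 1), (1, 1)}" for u v
    by (auto simp: noncontiguous_def grid_def zero_prod_def)
  have "(u, v) \<in> noncontiguous 3 c \<longleftrightarrow> (u, v) \<in> {0..<3} \<times> {2..<int c - 1}" for u v
  proof (cases "u = 0 \<or> u = 1 \<or> u = 2")
    case True
    have "0 \<le> v \<and> v < int c \<and> v \<noteq> 0 \<and> v \<noteq> 1 \<and> v \<noteq> int c - 1 \<longleftrightarrow> 2 \<le> v \<and> v < int c - 1"
      by presburger
    with True show ?thesis
      unfolding iff by (elim disjE) (simp_all, blast+)
  next
    case False
    then have "\<not> (0 \<le> u \<and> u < 3)"
      by linarith
    then show ?thesis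
      unfolding iff by auto
  qed
  then show ?thesis
    by auto
qed

section \<open>Base blocks and the differences they produce\<close>

text \<open>
  The parameter \<open>w\<close> stands for an inverse of 4 modulo \<open>c\<close>. The indices 1, 2, 3 are mere labels
  of the three exceptional base blocks.
\<close>

definition base_block :: "int \<Rightarrow> int \<Rightarrow> (int \<times> int) set" where
  "base_block w j =
    (if j = 1 then {(0, 0), (0, 2 * w), (0, 8 * w)}
     else if j = 2 then {(0, 0), (2, 3 * w), (1, w)}
     else if j = 3 then {(0, 0), (1, 3 * w), (2, 2 * w)}
     else {(0, 0), (1, j * w), (0, 2 * j * w)})"

text \<open>Signed representatives suit differences, which come in pairs of opposite sign: their
  absolute values up to \<open>m\<close> match the indices of Bose's blocks.\<close>

lemma balanced_residue:
  fixes x m :: int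
  assumes "m \<ge> 0"
  obtains e where "\<bar>e\<bar> \<le> m" "[e = x] (mod (2 * m + 1))"
proof -
  have "0 < 2 * m + 1"
    using assms by simp
  note bounds = pos_mod_sign[OF this, of x] pos_mod_bound[OF this, of x]
  show thesis
  proof (cases "x mod (2 * m + 1) \<le> m")
    case True
    then have "\<bar>x mod (2 * m + 1)\<bar> \<le> m"
      using bounds by linarith
    then show ?thesis
      by (rule that) (simp add: cong_def)
  next
    case False
    then have "\<bar>x mod (2 * m + 1) - (2 * m + 1)\<bar> \<le> m"
      using bounds by linarith
    then show ?thesis
      by (rule that) (simp add: cong_def)
  qed
qed

lemma base_blocks_cover:
  fixes m w :: int
  assumes m: "m \<ge> 4" and c: "int c = 2 * m + 1" and w: "[4 * w = 1] (mod int c)"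
  shows "{0..<3} \<times> {2..<int c - 1} \<subseteq>
    (\<lambda>(j, a, b). residue 3 c (b - a)) ` ordered_pairs ({1, 2, 3} \<union> {5..m}) (base_block w)"
proof -
  have w0: "w \<noteq> 0"
    using w m c by (auto simp: cong_def)
  \<comment> \<open>Here \<open>s\<close> is the column difference in quarters. Nothing is reduced
    yet, so \<open>R\<close> is symmetric under negation and each instance is an integer
    computation.\<close>
  define R where "R u s \<longleftrightarrow> (\<exists>j \<in> {1, 2, 3} \<union> {5..m}. \<exists>a \<in> base_block w j. \<exists>b \<in> base_block w j.
    a \<noteq> b \<and> b - a = (u, s * w))" for u s
  have neg: "R (- u) (- s)" if "R u s" for u s
    using that unfolding R_def by (metis (no_types, lifting) minus_diff_eq mult_minus_left uminus_Pair)
  have RI: "R u s"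
    if "j \<in> {1, 2, 3} \<union> {5..m}" "a \<in> base_block w j" "b \<in> base_block w j"
      "a \<noteq> b" "b - a = (u, s * w)" for j a b u s
    using that unfolding R_def by blast
  \<comment> \<open>The value \<open>h = 2\<close> is the forbidden difference of 4 quarters; the
    first exceptional block supplies \<open>h = 1, 3, 4\<close>.\<close>
  have R0: "R 0 (2 * h)" if h: "1 \<le> h" "h \<le> m" "h \<noteq> 2" for h
  proof -
    consider "h = 1" | "h = 3" | "h = 4" | "h \<ge> 5"
      using h by linarith
    then show ?thesis
    proof cases
      case 1
      then show ?thesis
        using w0 by (intro RI[of 1 "(0, 0)" "(0, 2 * w)"]) (auto simp: base_block_def)
    next
      case 2
      then show ?thesis
        using w0 by (intro RI[of 1 "(0, 2 * w)" "(0, 8 * w)"]) (auto simp: base_block_def)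
    next
      case 3
      then show ?thesis
        using w0 by (intro RI[of 1 "(0, 0)" "(0, 8 * w)"]) (auto simp: base_block_def)
    next
      case 4
      then show ?thesis
        using w0 h by (intro RI[of h "(0, 0)" "(0, 2 * h * w)"]) (auto simp: base_block_def)
    qed
  qed
  \<comment> \<open>Since levels are not reduced, a step from level 2 to level 0 appears as -2,
    which is 1 modulo 3.\<close>
  have R1: "R 1 s \<or> R (-2) s" if s: "1 \<le> \<bar>s\<bar>" "\<bar>s\<bar> \<le> m" "\<bar>s\<bar> \<noteq> 4" for s
  proof -
    consider "s = 1" | "s = 2" | "s = 3" | "s = -1" | "s = -2" | "s = -3" | "s \<ge> 5" | "s \<le> -5"
      using s by linarith
    then show ?thesis
    proof cases
      case 1
      then have "R 1 s"
        by (intro RI[of 2 "(0, 0)" "(1, w)"]) (auto simp: base_block_def)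
      then show ?thesis ..
    next
      case 2
      then have "R 1 s"
        by (intro RI[of 2 "(1, w)" "(2, 3 * w)"]) (auto simp: base_block_def)
      then show ?thesis ..
    next
      case 3
      then have "R 1 s"
        by (intro RI[of 3 "(0, 0)" "(1, 3 * w)"]) (auto simp: base_block_def)
      then show ?thesis ..
    next
      case 4
      then have "R 1 s"
        by (intro RI[of 3 "(1, 3 * w)" "(2, 2 * w)"]) (auto simp: base_block_def)
      then show ?thesis ..
    next
      case 5
      then have "R (-2) s"
        by (intro RI[of 3 "(2, 2 * w)" "(0, 0)"]) (auto simp: base_block_def)
      then show ?thesis ..
    next
      case 6
      then have "R (-2) s"
        by (intro RI[of 2 "(2, 3 * w)" "(0, 0)"]) (auto simp: base_block_def)
      then show ?thesis ..
    next
      case 7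
      then have "R 1 s"
        using s by (intro RI[of s "(0, 0)" "(1, s * w)"]) (auto simp: base_block_def)
      then show ?thesis ..
    next
      case 8
      then have "R 1 s"
        using s by (intro RI[of "- s" "(0, 2 * - s * w)" "(1, - s * w)"])
          (auto simp: base_block_def)
      then show ?thesis ..
    qed
  qed
  have main: "(u, v) \<in> (\<lambda>(j, a, b). residue 3 c (b - a)) ` ordered_pairs ({1, 2, 3} \<union> {5..m}) (base_block w)"
    if R: "R u' s" and u: "[u' = u] (mod 3)" "0 \<le> u" "u < 3"
      and v: "[s = 4 * v] (mod int c)" "0 \<le> v" "v < int c" for u v u' s
  proof -
    obtain j a b where "j \<in> {1, 2, 3} \<union> {5..m}" "a \<in> base_block w j" "b \<in> base_block w j"
      "a \<noteq> b" and d: "b - a = (u', s * w)"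
      using R unfolding R_def by blast
    then have jab: "(j, a, b) \<in> ordered_pairs ({1, 2, 3} \<union> {5..m}) (base_block w)"
      unfolding ordered_pairs_def by blast
    have "[s * w = v] (mod int c)"
    proof -
      have "[s * w = 4 * v * w] (mod int c)"
        using v(1) by (rule cong_mult) simp
      also have "[4 * v * w = v] (mod int c)"
        using cong_mult[OF w cong_refl[of v]] by (simp add: mult_ac)
      finally show ?thesis .
    qed
    then have "(u, v) = residue 3 c (b - a)"
      using u v by (simp add: d residue_def cong_def)
    then show ?thesis
      using jab by (intro image_eqI[of _ _ "(j, a, b)"]) simp_all
  qed
  have coprime: "coprime 2 (int c)" "coprime 4 (int c)"
    using coprime_power_left_iff[of "2 :: int" 2 "int c"] c by simp_all
  \<comment> \<open>Here \<open>t\<close> is a column offset -1, 0 or 1, so \<open>v - t\<close>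
    lies strictly between 0 and \<open>c\<close>; the factor \<open>k\<close> (2 or 4) cancels
    because \<open>c\<close> is odd.\<close>
  have far: "\<not> [k * t = k * v] (mod int c)"
    if "coprime k (int c)" "\<bar>t\<bar> \<le> 1" "2 \<le> v" "v < int c - 1" for k t v
  proof -
    have "\<not> int c dvd v - t"
      using that(2-4) by (auto dest!: zdvd_imp_le)
    then show ?thesis
      using cong_mult_lcancel[OF that(1)] by (simp add: cong_iff_dvd_diff dvd_diff_commute)
  qed
  show ?thesis
  proof safe
    fix u v :: int
    assume "u \<in> {0..<3}" "v \<in> {2..<int c - 1}"
    then have u: "u = 0 \<or> u = 1 \<or> u = 2" and v: "2 \<le> v" "v < int c - 1"
      by auto
    \<comment> \<open>Pairs on one level have even quarter differences \<open>2 * h\<close>, so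
      halves are balanced for level 0 and quarters for mixed levels.\<close>
    obtain h where h: "\<bar>h\<bar> \<le> m" "[h = 2 * v] (mod int c)"
      using balanced_residue[of m "2 * v"] m c by auto
    obtain s where s: "\<bar>s\<bar> \<le> m" "[s = 4 * v] (mod int c)"
      using balanced_residue[of m "4 * v"] m c by auto
    have "h \<noteq> 2 * t" if "\<bar>t\<bar> \<le> 1" for t
      using far[OF coprime(1) that v] h(2) by auto
    from this[of 0] this[of 1] this[of "-1"] have h': "1 \<le> \<bar>h\<bar>" "\<bar>h\<bar> \<noteq> 2"
      by auto
    have "s \<noteq> 4 * t" if "\<bar>t\<bar> \<le> 1" for t
      using far[OF coprime(2) that v] s(2) by auto
    from this[of 0] this[of 1] this[of "-1"] have s': "1 \<le> \<bar>s\<bar>" "\<bar>s\<bar> \<noteq> 4"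
      by auto
    have v': "0 \<le> v" "v < int c"
      using v by simp_all
    from u show "(u, v) \<in> (\<lambda>(j, a, b). residue 3 c (b - a)) `
        ordered_pairs ({1, 2, 3} \<union> {5..m}) (base_block w)"
    proof (elim disjE)
      assume u: "u = 0"
      have "R 0 (2 * h)"
        using R0[of "\<bar>h\<bar>"] neg[of 0 "2 * \<bar>h\<bar>"] h(1) h' by (cases "h \<ge> 0") auto
      moreover have "[2 * h = 4 * v] (mod int c)"
        using cong_mult[OF cong_refl[of 2] h(2)] by simp
      ultimately show ?thesis
        using u v' by (intro main[of 0 "2 * h"]) simp_all
    next
      assume u: "u = 1"
      have "R 1 s \<or> R (-2) s"
        using R1 s(1) s' by simp
      then show ?thesis
      proof
        assume "R 1 s"
        then show ?thesis
          using u v' s(2) by (intro main[of 1 s]) simp_all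
      next
        assume "R (-2) s"
        then show ?thesis
          using u v' s(2) by (intro main[of "-2" s]) (simp_all add: cong_def)
      qed
    next
      assume u: "u = 2"
      \<comment> \<open>Level difference 2 is the negative of 1 modulo 3, so reversing the pairs
        found for \<open>- s\<close> suffices.\<close>
      have "R (-1) s \<or> R 2 s"
        using R1[of "- s"] neg[of 1 "- s"] neg[of "-2" "- s"] s(1) s' by auto
      then show ?thesis
      proof
        assume "R (-1) s"
        then show ?thesis
          using u v' s(2) by (intro main[of "-1" s]) (simp_all add: cong_def)
      next
        assume "R 2 s"
        then show ?thesis
          using u v' s(2) by (intro main[of 2 s]) simp_all
      qed
    qed
  qed
qed

theorem theorem4p4:
  fixes c :: nat
  assumes "odd c" and "c \<ge> 9"
  shows "\<exists>X \<B>. BSA2_IS 3 c 3 1 X \<B>"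
proof -
  obtain n where n: "c = 2 * n + 1"
    using assms(1) by (auto elim: oddE)
  define m where "m = int n"
  \<comment> \<open>The bound 9 on \<open>c\<close> ensures that the four deleted indices 1 to 4 all
    occur; for \<open>c = 9\<close> only the exceptional blocks remain.\<close>
  have m: "m \<ge> 4" "int c = 2 * m + 1"
    using n assms(2) by (auto simp: m_def)
  have "coprime 4 (int c)"
    using coprime_power_left_iff[of "2 :: int" 2 "int c"] assms(1) by simp
  then obtain w where w: "[4 * w = 1] (mod int c)"
    using cong_solve_coprime_int by auto
  \<comment> \<open>This separates the points of a base block as integer pairs; that they stay
    distinct after reduction follows from the difference count.\<close>
  then have w0: "w \<noteq> 0"
    using assms(2) by (auto simp: cong_def)
  have J: "{1, 2, 3} \<inter> {5..m} = {}" "card {1, 2, 3 :: int} = 3"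
    by auto
  show ?thesis
  proof (intro exI, rule BSA2_IS_of_difference_cover[of 3 c "{1, 2, 3} \<union> {5..m}" "base_block w"])
    show "noncontiguous 3 c \<subseteq> (\<lambda>(j, a, b). residue 3 c (b - a)) `
        ordered_pairs ({1, 2, 3} \<union> {5..m}) (base_block w)"
      using base_blocks_cover[OF m w] noncontiguous_3[of c] assms(2) by simp
    \<comment> \<open>Both sides equal \<open>6 * (n - 1)\<close>: there are
      \<open>3 + (n - 4)\<close> base blocks with 6 ordered pairs each, and 3 rows of
      \<open>c - 3\<close> admissible columns.\<close>
    show "card ({1, 2, 3} \<union> {5..m}) * (3 * (3 - 1)) = card (noncontiguous 3 c)"
      using m noncontiguous_3[of c] assms(2) J n
      by (subst card_Un_disjoint) (auto simp: m_def card_cartesian_product)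
    show "3 > (0 :: nat)" "c > 0" "finite ({1, 2, 3} \<union> {5..m})"
      using assms(2) by simp_all
  next
    fix j assume "j \<in> {1, 2, 3} \<union> {5..m}"
    then show "finite (base_block w j)" "card (base_block w j) = 3"
      using w0 by (auto simp: base_block_def)
  qed
qed

end
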